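(* Let $K$ be a field and let $A=\{x_i\mid i\in I\}$ be a well-ordered set, where $I$ is ordered so that $x_i>x_j$ if and only if $i>j$. Let $S\subseteq K\langle A\rangle$ be the set consisting of the polynomials $x_ix_jx_k-x_jx_ix_k$, $x_ix_kx_j-x_jx_ix_k$ and $x_ix_jx_ix_k-x_ix_kx_ix_j$ for all $i>j>k$ in $I$, and $x_ix_jx_j-x_jx_ix_j$ and $x_ix_ix_j-x_ix_jx_i$ for all $i>j$ in $I$. Let $\Omega\subseteq A^*$ be the set of staircase words defined in the context. Then $\Omega$ is a basis of the Chinese algebra $K\langle A\mid S\rangle$ as a $K$-space.
   Context: $A^*$ is the free monoid on $A$ (empty word $=1$), $K\langle A\rangle$ is the free associative algebra over $K$ generated by $A$, and $K\langle A\mid S\rangle=K\langle A\rangle/\mathrm{Id}(S)$, where $\mathrm{Id}(S)$ is the two-sided ideal generated by $S$. The Chinese monoid $CH(A)$ is the quotient of $A^*$ by the congruence generated by the relations $x_ix_jx_k=x_ix_kx_j=x_jx_ix_k$ for all $i>j>k$, and $x_ix_jx_j=x_jx_ix_j$, $x_ix_ix_j=x_ix_jx_i$ for all $i>j$. The Chinese algebra is the semigroup algebra of $CH(A)$ over $K$; the relations given by $S$ define the same monoid, so the Chinese algebra is $K\langle A\mid S\rangle$. $\Omega$ is the set of all words on $A$ of the form $u_n=w_1w_2\cdots w_n$, $n\ge 0$ ($u_0$ is the empty word), where $x_1<x_2<\cdots<x_n$ are elements of $A$ (here $x_1,\dots,x_n$ is a local naming of an arbitrary finite increasing sequence in $A$),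 $w_1=x_1^{t_{1,1}}$, and for $2\le k\le n$ $$w_k=\Big(\prod_{1\le i\le k-1}(x_kx_i)^{t_{k,i}}\Big)x_k^{t_{k,k}}=(x_kx_1)^{t_{k,1}}(x_kx_2)^{t_{k,2}}\cdots(x_kx_{k-1})^{t_{k,k-1}}x_k^{t_{k,k}},$$ with all exponents $t_{k,i}$ non-negative integers. Words of $A^*$ are identified with their images in $K\langle A\mid S\rangle$; the assertion that $\Omega$ is a basis means that the images of distinct words of $\Omega$ are distinct and together form a $K$-basis. *)

theory Defs
  imports "HOL-Library.Poly_Mapping" "HOL-Algebra.QuotRing" "Jordan_Normal_Form.VS_Connect"
begin

text \<open>Lists under concatenation are the free monoid. It is registered additively, because the
  convolution product of \<^theory>\<open>HOL-Library.Poly_Mapping\<close> expects an additive monoid of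
  exponents; the empty word is \<open>0\<close>.\<close>

instantiation list :: (type) monoid_add
begin

definition plus_list :: "'a list \<Rightarrow> 'a list \<Rightarrow> 'a list" where
  "plus_list = append"

definition zero_list :: "'a list" where
  "zero_list = []"

instance
  by standard (simp_all add: plus_list_def zero_list_def)

end

abbreviation word :: "'a list \<Rightarrow> ('a list \<Rightarrow>\<^sub>0 'k::field)" where
  "word w \<equiv> Poly_Mapping.single w 1"

definition free_algebra :: "'a set \<Rightarrow> ('k::field, 'a list \<Rightarrow>\<^sub>0 'k) module" where
  "free_algebra A =
     \<lparr>carrier = {p. Poly_Mapping.keys p \<subseteq> lists A}, monoid.mult = (*), one = 1, ring.zero = 0, add = (+),
      smult = (\<lambda>c. Poly_Mapping.map ((*) c))\<rparr>"

text \<open>The quotient ring by an ideal \<open>J\<close>, with the scalar multiplication \<open>c (J + p) = J + c p\<close>;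
  the latter is written as in \<^const>\<open>rcoset_mult\<close>, without choosing representatives.\<close>

definition quot_algebra :: "('k, 'b, 'm) module_scheme \<Rightarrow> 'b set \<Rightarrow> ('k, 'b set) module" where
  "quot_algebra R J =
     ring.extend (R Quot J) (module.fields (\<lambda>c U. \<Union>p\<in>U. J +>\<^bsub>R\<^esub> (c \<odot>\<^bsub>R\<^esub> p)))"

definition presented_algebra ::
    "'a set \<Rightarrow> ('a list \<Rightarrow>\<^sub>0 'k::field) set \<Rightarrow> ('k, ('a list \<Rightarrow>\<^sub>0 'k) set) module" where
  "presented_algebra A S = quot_algebra (free_algebra A) (Idl\<^bsub>free_algebra A\<^esub> S)"

definition word_class ::
    "'a set \<Rightarrow> ('a list \<Rightarrow>\<^sub>0 'k::field) set \<Rightarrow> 'a list \<Rightarrow> ('a list \<Rightarrow>\<^sub>0 'k) set" where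
  "word_class A S w = Idl\<^bsub>free_algebra A\<^esub> S +>\<^bsub>free_algebra A\<^esub> word w"

definition chinese_relations :: "'a::linorder set \<Rightarrow> ('a list \<Rightarrow>\<^sub>0 'k::field) set" where
  "chinese_relations A =
     {word [i, j, k] - word [j, i, k] | i j k. i \<in> A \<and> j \<in> A \<and> k \<in> A \<and> i > j \<and> j > k} \<union>
     {word [i, k, j] - word [j, i, k] | i j k. i \<in> A \<and> j \<in> A \<and> k \<in> A \<and> i > j \<and> j > k} \<union>
     {word [i, j, i, k] - word [i, k, i, j] | i j k. i \<in> A \<and> j \<in> A \<and> k \<in> A \<and> i > j \<and> j > k} \<union>
     {word [i, j, j] - word [j, i, j] | i j. i \<in> A \<and> j \<in> A \<and> i > j} \<union>
     {word [i, i, j] - word [i, j, i] | i j. i \<in> A \<and> j \<in> A \<and> i > j}"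

text \<open>The factor \<open>w\<^sub>k = (x\<^sub>k x\<^sub>1)\<^bsup>t k 1\<^esup> \<dots> (x\<^sub>k x\<^sub>k\<^sub>-\<^sub>1)\<^bsup>t k (k-1)\<^esup> x\<^sub>k\<^bsup>t k k\<^esup>\<close>; for \<open>k = 1\<close> the
  product over \<open>i\<close> is empty.\<close>

definition staircase_row :: "(nat \<Rightarrow> 'a) \<Rightarrow> (nat \<Rightarrow> nat \<Rightarrow> nat) \<Rightarrow> nat \<Rightarrow> 'a list" where
  "staircase_row x t k =
     concat (map (\<lambda>i. concat (replicate (t k i) [x k, x i])) [1..<k]) @ replicate (t k k) (x k)"

definition staircase_word :: "(nat \<Rightarrow> 'a) \<Rightarrow> (nat \<Rightarrow> nat \<Rightarrow> nat) \<Rightarrow> nat \<Rightarrow> 'a list" where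
  "staircase_word x t n = concat (map (staircase_row x t) [1..<Suc n])"

definition staircase_words :: "'a::linorder set \<Rightarrow> 'a list set" where
  "staircase_words A =
     {staircase_word x t n | x t n. x ` {1..n} \<subseteq> A \<and> strict_mono_on {1..n} x}"

text \<open>\<^const>\<open>free_algebra\<close> is a ring and \<^const>\<open>presented_algebra\<close> is a vector space over \<open>K\<close>,
  so the locale predicate \<open>vectorspace.basis\<close> applies to it.\<close>

lemma free_algebra_mult_closed:
  fixes p q :: "'a list \<Rightarrow>\<^sub>0 'k::field"
  assumes "Poly_Mapping.keys p \<subseteq> lists A" "Poly_Mapping.keys q \<subseteq> lists A"
  shows "Poly_Mapping.keys (p * q) \<subseteq> lists A"
  using keys_mult[of p q] assms by (fastforce simp: plus_list_def)

lemma keys_single_zero: "Poly_Mapping.keys (Poly_Mapping.single 0 c) \<subseteq> lists A"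
  by (auto simp: zero_list_def)

lemma ring_free_algebra: "ring (free_algebra A :: ('k::field, 'a list \<Rightarrow>\<^sub>0 'k) module)"
proof (rule ringI)
  show "abelian_group (free_algebra A :: ('k, 'a list \<Rightarrow>\<^sub>0 'k) module)"
  proof (rule abelian_groupI)
    fix p :: "'a list \<Rightarrow>\<^sub>0 'k" assume "p \<in> carrier (free_algebra A)"
    then show "\<exists>q\<in>carrier (free_algebra A). q \<oplus>\<^bsub>free_algebra A\<^esub> p = \<zero>\<^bsub>free_algebra A\<^esub>"
      by (intro bexI[of _ "- p"]) (simp_all add: free_algebra_def keys.rep_eq)
  next
    fix p q :: "'a list \<Rightarrow>\<^sub>0 'k"
    assume "p \<in> carrier (free_algebra A)" "q \<in> carrier (free_algebra A)"
    then show "p \<oplus>\<^bsub>free_algebra A\<^esub> q \<in> carrier (free_algebra A)"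
      using Poly_Mapping.keys_add[of p q] by (auto simp: free_algebra_def)
  qed (simp_all add: free_algebra_def algebra_simps)
  show "Group.monoid (free_algebra A :: ('k, 'a list \<Rightarrow>\<^sub>0 'k) module)"
    by (rule Group.monoidI)
      (auto simp: free_algebra_def algebra_simps zero_list_def
        dest: free_algebra_mult_closed[THEN subsetD, rotated 2])
qed (simp_all add: free_algebra_def algebra_simps)

context
  fixes A :: "'a set" and J :: "('a list \<Rightarrow>\<^sub>0 'k::field) set"
  assumes J: "ideal J (free_algebra A)"
begin

interpretation J: ideal J "free_algebra A" by (fact J)

lemma smult_closed:
  "p \<in> carrier (free_algebra A) \<Longrightarrow> c \<odot>\<^bsub>free_algebra A\<^esub> p \<in> carrier (free_algebra A)"
  for p :: "'a list \<Rightarrow>\<^sub>0 'k"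
  using free_algebra_mult_closed[OF keys_single_zero]
  by (simp add: free_algebra_def mult_map_scale_conv_mult)

lemma smult_conv_mult: "c \<odot>\<^bsub>free_algebra A\<^esub> p = Poly_Mapping.single 0 c \<otimes>\<^bsub>free_algebra A\<^esub> p"
  for p :: "'a list \<Rightarrow>\<^sub>0 'k"
  by (simp add: free_algebra_def mult_map_scale_conv_mult)

lemma scalar_carrier: "(Poly_Mapping.single 0 c :: 'a list \<Rightarrow>\<^sub>0 'k) \<in> carrier (free_algebra A)"
  using keys_single_zero[of c A] by (simp add: free_algebra_def)

lemma quot_algebra_smult:
  fixes p :: "'a list \<Rightarrow>\<^sub>0 'k"
  assumes p: "p \<in> carrier (free_algebra A)"
  shows "c \<odot>\<^bsub>quot_algebra (free_algebra A) J\<^esub> (J +>\<^bsub>free_algebra A\<^esub> p)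
    = J +>\<^bsub>free_algebra A\<^esub> (c \<odot>\<^bsub>free_algebra A\<^esub> p)"
proof -
  let ?F = "free_algebra A :: ('k, 'a list \<Rightarrow>\<^sub>0 'k) module"
  have *: "J +>\<^bsub>?F\<^esub> (c \<odot>\<^bsub>?F\<^esub> q) = J +>\<^bsub>?F\<^esub> (c \<odot>\<^bsub>?F\<^esub> p)" if q: "q \<in> J +>\<^bsub>?F\<^esub> p" for q
  proof -
    obtain h where h: "h \<in> J" "q = h \<oplus>\<^bsub>?F\<^esub> p"
      using q by (auto simp: a_r_coset_def r_coset_def)
    have "Poly_Mapping.single 0 c \<otimes>\<^bsub>?F\<^esub> h \<in> J"
      using h(1) scalar_carrier by (rule J.I_l_closed)
    moreover have "c \<odot>\<^bsub>?F\<^esub> q = (Poly_Mapping.single 0 c \<otimes>\<^bsub>?F\<^esub> h) \<oplus>\<^bsub>?F\<^esub> (c \<odot>\<^bsub>?F\<^esub> p)"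
      unfolding h(2) smult_conv_mult
      using h(1) p scalar_carrier J.a_Hcarr by (simp add: J.r_distr)
    ultimately have "c \<odot>\<^bsub>?F\<^esub> q \<in> J +>\<^bsub>?F\<^esub> (c \<odot>\<^bsub>?F\<^esub> p)"
      by (auto simp: a_r_coset_def r_coset_def)
    then show ?thesis
      by (rule J.a_repr_independence[OF _ smult_closed[OF p] J.a_subgroup, symmetric])
  qed
  have "c \<odot>\<^bsub>quot_algebra ?F J\<^esub> (J +>\<^bsub>?F\<^esub> p)
      = (\<Union>q\<in>J +>\<^bsub>?F\<^esub> p. J +>\<^bsub>?F\<^esub> (c \<odot>\<^bsub>?F\<^esub> q))"
    by (simp add: quot_algebra_def ring.extend_def module.fields_def)
  also have "\<dots> = (\<Union>q\<in>J +>\<^bsub>?F\<^esub> p. J +>\<^bsub>?F\<^esub> (c \<odot>\<^bsub>?F\<^esub> p))"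
    by (rule SUP_cong[OF refl *])
  also have "\<dots> = J +>\<^bsub>?F\<^esub> (c \<odot>\<^bsub>?F\<^esub> p)"
    using J.a_rcos_self[OF p] by blast
  finally show ?thesis .
qed

lemma quot_algebra_ring_simps:
  "carrier (quot_algebra (free_algebra A) J) = carrier (free_algebra A Quot J)"
  "add (quot_algebra (free_algebra A) J) = add (free_algebra A Quot J)"
  "ring.zero (quot_algebra (free_algebra A) J) = ring.zero (free_algebra A Quot J)"
  "monoid.mult (quot_algebra (free_algebra A) J) = monoid.mult (free_algebra A Quot J)"
  "one (quot_algebra (free_algebra A) J) = one (free_algebra A Quot J)"
  by (simp_all add: quot_algebra_def ring.extend_def)

lemma vectorspace_quot_algebra: "vectorspace class_ring (quot_algebra (free_algebra A) J)"
proof -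
  let ?F = "free_algebra A :: ('k, 'a list \<Rightarrow>\<^sub>0 'k) module"
  let ?Q = "quot_algebra ?F J"
  interpret Q: ring "?F Quot J" by (rule J.quotient_is_ring)
  have rep: "\<exists>p\<in>carrier ?F. U = J +>\<^bsub>?F\<^esub> p" if "U \<in> carrier ?Q" for U
    using that by (auto simp: quot_algebra_ring_simps FactRing_simps)
  have cls: "J +>\<^bsub>?F\<^esub> p \<in> carrier ?Q" if "p \<in> carrier ?F" for p
    using that by (auto simp: quot_algebra_ring_simps FactRing_simps)
  have add: "(J +>\<^bsub>?F\<^esub> p) \<oplus>\<^bsub>?Q\<^esub> (J +>\<^bsub>?F\<^esub> q) = J +>\<^bsub>?F\<^esub> (p \<oplus>\<^bsub>?F\<^esub> q)"
    if "p \<in> carrier ?F" "q \<in> carrier ?F" for p q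
    using that by (simp add: quot_algebra_ring_simps FactRing_def J.a_rcos_sum)
  have "abelian_group ?Q"
    by (rule abelian_groupI; unfold quot_algebra_ring_simps)
      (fact Q.add.m_closed Q.zero_closed Q.a_assoc Q.a_comm Q.l_zero Q.add.l_inv_ex)+
  moreover have "cring (class_ring :: 'k ring)"
    by (rule domain.axioms(1)[OF field.axioms(1)[OF class_field]])
  moreover have "module_axioms (class_ring :: 'k ring) ?Q"
  proof
    fix c d :: 'k and U V
    assume "U \<in> carrier ?Q"
    then obtain p where p: "p \<in> carrier ?F" and U: "U = J +>\<^bsub>?F\<^esub> p"
      using rep by blast
    show "c \<odot>\<^bsub>?Q\<^esub> U \<in> carrier ?Q"
      by (simp add: U p quot_algebra_smult cls smult_closed)
    show "(c \<oplus>\<^bsub>class_ring\<^esub> d) \<odot>\<^bsub>?Q\<^esub> U = c \<odot>\<^bsub>?Q\<^esub> U \<oplus>\<^bsub>?Q\<^esub> d \<odot>\<^bsub>?Q\<^esub> U"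
      unfolding U by (simp add: p quot_algebra_smult add smult_closed)
        (simp add: free_algebra_def mult_map_scale_conv_mult single_add distrib_right class_ring_simps)
    show "(c \<otimes>\<^bsub>class_ring\<^esub> d) \<odot>\<^bsub>?Q\<^esub> U = c \<odot>\<^bsub>?Q\<^esub> (d \<odot>\<^bsub>?Q\<^esub> U)"
      unfolding U by (simp add: p quot_algebra_smult smult_closed)
        (simp add: free_algebra_def mult_map_scale_conv_mult mult_single flip: mult.assoc)
    show "\<one>\<^bsub>class_ring\<^esub> \<odot>\<^bsub>?Q\<^esub> U = U"
      unfolding U by (simp add: p quot_algebra_smult)
        (simp add: free_algebra_def mult_map_scale_conv_mult)
    assume "V \<in> carrier ?Q"
    then obtain q where q: "q \<in> carrier ?F" and V: "V = J +>\<^bsub>?F\<^esub> q"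
      using rep by blast
    have pq: "p \<oplus>\<^bsub>?F\<^esub> q \<in> carrier ?F"
      using p q by simp
    show "c \<odot>\<^bsub>?Q\<^esub> (U \<oplus>\<^bsub>?Q\<^esub> V) = c \<odot>\<^bsub>?Q\<^esub> U \<oplus>\<^bsub>?Q\<^esub> c \<odot>\<^bsub>?Q\<^esub> V"
      unfolding U V by (simp add: p q pq quot_algebra_smult add smult_closed)
        (simp add: free_algebra_def mult_map_scale_conv_mult distrib_left)
  qed
  ultimately show ?thesis
    by (simp add: vectorspace_def Module.module_def class_field)
qed

end

lemma chinese_relations_carrier:
  "(chinese_relations A :: ('a::linorder list \<Rightarrow>\<^sub>0 'k::field) set) \<subseteq> carrier (free_algebra A)"
proof -
  have *: "word v - (word w :: 'a list \<Rightarrow>\<^sub>0 'k) \<in> carrier (free_algebra A)"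
    if "set v \<subseteq> A" "set w \<subseteq> A" for v w
  proof -
    have "Poly_Mapping.keys (word v - (word w :: 'a list \<Rightarrow>\<^sub>0 'k)) \<subseteq> {v} \<union> {w}"
      using Poly_Mapping.keys_diff[of "word v :: 'a list \<Rightarrow>\<^sub>0 'k" "word w"] by simp
    moreover have "{v} \<union> {w} \<subseteq> lists A"
      using that by auto
    ultimately show ?thesis
      unfolding free_algebra_def by (simp only: partial_object.simps mem_Collect_eq)
  qed
  show ?thesis
    unfolding chinese_relations_def by (intro subsetI, elim UnE CollectE exE conjE) (simp_all add: *)
qed

lemma vectorspace_presented_algebra:
  assumes "S \<subseteq> carrier (free_algebra A)"
  shows "vectorspace class_ring (presented_algebra A S)"
  unfolding presented_algebra_def
  by (intro vectorspace_quot_algebra ring.genideal_ideal ring_free_algebra assms)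

end

theory Submission
  imports Defs "HOL-Library.Multiset"
begin

text \<open>Modulo the defining relations, a letter appended to a staircase word is absorbed into it by an
  insertion algorithm: in the row of the maximal letter it either completes a pair or pushes another
  letter out to the left, into the staircase of the smaller letters. Hence \<open>\<Omega>\<close> spans.

  For independence, let \<open>P\<close> be a lower set and \<open>Q\<close> an upper set of letters disjoint from \<open>P\<close>.
  Sending \<open>P\<close> to \<open>p\<close>, \<open>Q\<close> to \<open>q\<close> and all other letters to \<open>1\<close> is compatible with the Chinese
  relations in the bicyclic monoid \<open>\<langle>p, q | q p = 1\<rangle>\<close>. On a staircase word, the number of \<open>p\<close>'s left
  uncancelled counts the letters from \<open>P\<close> in the rows of letters outside \<open>Q\<close>; together with the
  content of the word these numbers determine all exponents. Hence a linear functional that is constant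
  on words with equal invariants kills the ideal and separates the words of \<open>\<Omega>\<close>.\<close>

section \<open>The Chinese congruence on words and its commutation rules\<close>

text \<open>The letters range over the whole type. Congruent words have the same letters, so a
  derivation that starts over \<open>A\<close> stays over \<open>A\<close> and only uses relations
  from \<open>chinese_relations A\<close>.\<close>

inductive chinese_cong :: "'a::linorder list \<Rightarrow> 'a list \<Rightarrow> bool" (infix "\<approx>" 50) where
  refl: "u \<approx> u"
| sym: "u \<approx> v \<Longrightarrow> v \<approx> u"
| trans: "u \<approx> v \<Longrightarrow> v \<approx> w \<Longrightarrow> u \<approx> w"
| congr: "u \<approx> v \<Longrightarrow> p @ u @ q \<approx> p @ v @ q"
| ijk: "i > j \<Longrightarrow> j > k \<Longrightarrow> [i, j, k] \<approx> [j, i, k]"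
| ikj: "i > j \<Longrightarrow> j > k \<Longrightarrow> [i, k, j] \<approx> [j, i, k]"
| ijik: "i > j \<Longrightarrow> j > k \<Longrightarrow> [i, j, i, k] \<approx> [i, k, i, j]"
| ijj: "i > j \<Longrightarrow> [i, j, j] \<approx> [j, i, j]"
| iij: "i > j \<Longrightarrow> [i, i, j] \<approx> [i, j, i]"

lemmas [trans] = chinese_cong.trans
lemmas [simp] = chinese_cong.refl

lemma chinese_cong_append: "u \<approx> u' \<Longrightarrow> v \<approx> v' \<Longrightarrow> u @ v \<approx> u' @ v'"
  using chinese_cong.congr[of u u' "[]" v] chinese_cong.congr[of v v' u' "[]"]
  by (auto intro: chinese_cong.trans)

lemma chinese_cong_left: "v \<approx> v' \<Longrightarrow> u @ v \<approx> u @ v'"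
  by (simp add: chinese_cong_append)

lemma chinese_cong_right: "u \<approx> u' \<Longrightarrow> u @ v \<approx> u' @ v"
  by (simp add: chinese_cong_append)

lemma chinese_cong_set_eq: "u \<approx> v \<Longrightarrow> set u = set v"
  by (induction rule: chinese_cong.induct) auto

lemma chinese_cong_power_commute:
  assumes "u @ v \<approx> v @ u"
  shows "concat (replicate n u) @ v \<approx> v @ concat (replicate n u)"
proof (induction n)
  case (Suc n)
  have "u @ (concat (replicate n u) @ v) \<approx> u @ (v @ concat (replicate n u))"
    by (rule chinese_cong_left[OF Suc.IH])
  also have "(u @ v) @ concat (replicate n u) \<approx> (v @ u) @ concat (replicate n u)"
    by (rule chinese_cong_right[OF assms])
  then have "u @ (v @ concat (replicate n u)) \<approx> v @ u @ concat (replicate n u)" by simp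
  finally show ?case by simp
qed simp

lemma pair_pair_commute:
  assumes "a < c" "b < c"
  shows "[c, a] @ [c, b] \<approx> [c, b] @ [c, a]"
  using assms
  by (cases a b rule: linorder_cases) (auto intro: chinese_cong.ijik chinese_cong.sym)

text \<open>This is \<open>ikj\<close> for \<open>a < b\<close> and \<open>ijj\<close> for
  \<open>a = b\<close>. It lets a letter escape to the left through pairs whose second component is
  not larger.\<close>

lemma pair_letter_commute:
  assumes "a \<le> b" "b < c"
  shows "[c, a] @ [b] \<approx> [b] @ [c, a]"
  using assms
  by (cases a b rule: linorder_cases) (auto intro: chinese_cong.ikj chinese_cong.ijj)

text \<open>The elementary bump, given by \<open>ijk\<close>: the smaller letter takes the place of
  \<open>b\<close> in the pair, and \<open>b\<close> comes out on the left.\<close>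

lemma pair_letter_swap:
  assumes "a < b" "b < c"
  shows "[c, b] @ [a] \<approx> [b] @ [c, a]"
  using assms by (auto intro: chinese_cong.ijk)

section \<open>Pair blocks and bumping\<close>

text \<open>The leading letter \<open>c\<close> is independent of the bound \<open>k\<close>, so
  that an induction can truncate the block while its pairs keep the leading letter of the full
  row.\<close>

definition pair_block :: "'a \<Rightarrow> (nat \<Rightarrow> 'a) \<Rightarrow> (nat \<Rightarrow> nat) \<Rightarrow> nat \<Rightarrow> 'a list" where
  "pair_block c x r k = concat (map (\<lambda>i. concat (replicate (r i) [c, x i])) [1..<k])"

lemma staircase_row_conv: "staircase_row x t k = pair_block (x k) x (t k) k @ replicate (t k k) (x k)"
  by (simp add: staircase_row_def pair_block_def)

lemma pair_block_0 [simp]: "pair_block c x r 0 = []"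
  by (simp add: pair_block_def)

lemma pair_block_Suc_0 [simp]: "pair_block c x r (Suc 0) = []"
  by (simp add: pair_block_def)

lemma pair_block_Suc:
  "k \<ge> 1 \<Longrightarrow> pair_block c x r (Suc k) = pair_block c x r k @ concat (replicate (r k) [c, x k])"
  by (simp add: pair_block_def)

lemma pair_block_cong:
  "(\<And>i. 1 \<le> i \<Longrightarrow> i < k \<Longrightarrow> r i = r' i) \<Longrightarrow> pair_block c x r k = pair_block c x r' k"
  unfolding pair_block_def by (intro arg_cong[where f = concat] map_cong) auto

lemma pair_block_commute:
  assumes "\<And>i. 1 \<le> i \<Longrightarrow> i < k \<Longrightarrow> [c, x i] @ v \<approx> v @ [c, x i]"
  shows "pair_block c x r k @ v \<approx> v @ pair_block c x r k"
  using assms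
proof (induction k)
  case (Suc k)
  show ?case
  proof (cases "k = 0")
    case False
    let ?u = "concat (replicate (r k) [c, x k])"
    have "pair_block c x r k @ (?u @ v) \<approx> pair_block c x r k @ (v @ ?u)"
      using Suc.prems[of k] False
      by (intro chinese_cong_left chinese_cong_power_commute) auto
    also have "(pair_block c x r k @ v) @ ?u \<approx> (v @ pair_block c x r k) @ ?u"
      using Suc.prems by (intro chinese_cong_right Suc.IH) auto
    then have "pair_block c x r k @ (v @ ?u) \<approx> v @ pair_block c x r k @ ?u" by simp
    finally show ?thesis using False by (simp add: pair_block_Suc)
  qed simp
qed simp

lemma concat_replicate_Suc_right: "concat (replicate (Suc n) u) = concat (replicate n u) @ u"
  by (induction n) auto

text \<open>Pairs with the same leading letter commute, so the new pair travels left past the groups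
  of index above \<open>m\<close> and joins its own group.\<close>

lemma pair_block_insert:
  assumes "\<And>i. 1 \<le> i \<Longrightarrow> i < k \<Longrightarrow> x i < c" "1 \<le> m" "m < k"
  shows "pair_block c x r k @ [c, x m] \<approx> pair_block c x (r(m := Suc (r m))) k"
  using assms
proof (induction k)
  case (Suc k)
  then have k: "k \<ge> 1" by simp
  let ?u = "concat (replicate (r k) [c, x k])" and ?r = "r(m := Suc (r m))"
  show ?case
  proof (cases "m = k")
    case True
    have "pair_block c x r k = pair_block c x ?r k"
      using True by (intro pair_block_cong) auto
    then have "pair_block c x r (Suc k) @ [c, x k] = pair_block c x ?r (Suc k)"
      unfolding pair_block_Suc[OF k] True fun_upd_same concat_replicate_Suc_right by simp
    then show ?thesis using True by (metis chinese_cong.refl)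
  next
    case False
    have "pair_block c x r k @ (?u @ [c, x m]) \<approx> pair_block c x r k @ ([c, x m] @ ?u)"
      using Suc.prems k
      by (intro chinese_cong_left chinese_cong_power_commute pair_pair_commute) auto
    also have "(pair_block c x r k @ [c, x m]) @ ?u \<approx> pair_block c x ?r k @ ?u"
      using Suc.prems False by (intro chinese_cong_right Suc.IH) auto
    then have "pair_block c x r k @ ([c, x m] @ ?u) \<approx> pair_block c x ?r k @ ?u" by simp
    finally show ?thesis
      using False by (simp add: pair_block_Suc[OF k] fun_upd_other del: fun_upd_apply)
  qed
qed simp

text \<open>The letter that leaves the block is the larger of \<open>x m\<close> and the largest second
  component of a pair; in the latter case \<open>x m\<close> takes its place in that pair.\<close>

lemma pair_block_bump:
  assumes x: "strict_mono_on {1..n} x" and "1 \<le> m" "m < n" "k \<le> n"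
  shows "\<exists>j r'. 1 \<le> j \<and> j < n \<and> pair_block (x n) x r k @ [x m] \<approx> [x j] @ pair_block (x n) x r' k"
  using \<open>k \<le> n\<close>
proof (induction k)
  case 0
  then show ?case using assms by auto
next
  case (Suc k)
  note less = strict_mono_onD[OF x]
  let ?c = "x n"
  \<comment> \<open>In the third case no second component exceeds \<open>x m\<close>, which
    therefore passes through the whole block. In the fourth the last group is nonempty and its
    second component \<open>x k\<close> is larger than \<open>x m\<close>, so a bump
    happens.\<close>
  consider "k = 0" | "k \<ge> 1" "r k = 0" | "k \<ge> 1" "k \<le> m" | "m < k" "r k > 0"
    by linarith
  then show ?case
  proof cases
    case 1
    then show ?thesis using assms by auto
  next
    case 2
    obtain j r' where j: "1 \<le> j" "j < n"
      "pair_block ?c x r k @ [x m] \<approx> [x j] @ pair_block ?c x r' k"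
      using Suc by force
    \<comment> \<open>The induction hypothesis does not control \<open>r' k\<close>; resetting it to
      0 makes the last group of the longer block empty.\<close>
    have "pair_block ?c x (r'(k := 0)) k = pair_block ?c x r' k"
      by (intro pair_block_cong) auto
    with j 2 have "pair_block ?c x r (Suc k) @ [x m] \<approx> [x j] @ pair_block ?c x (r'(k := 0)) (Suc k)"
      by (simp add: pair_block_Suc)
    with j show ?thesis by blast
  next
    case 3
    have "pair_block ?c x r (Suc k) @ [x m] \<approx> [x m] @ pair_block ?c x r (Suc k)"
    proof (intro pair_block_commute pair_letter_commute)
      fix i assume "1 \<le> i" "i < Suc k"
      then show "x i \<le> x m"
        using less[of i m] 3 assms by (cases "i = m") auto
    qed (use less[of m n] assms in auto)
    then show ?thesis using assms by blast
  next
    case 4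
    \<comment> \<open>One pair \<open>[?c, x k]\<close> is taken from the last group and swapped
      with \<open>x m\<close>. Then \<open>x k\<close> leaves to the left, and the pair
      \<open>[?c, x m]\<close> is sorted back into the block.\<close>
    let ?r = "r(k := r k - 1)"
    have lt: "x i < ?c" if "1 \<le> i" "i < Suc k" for i
      using less[of i n] that Suc.prems by auto
    have "concat (replicate (r k) [?c, x k]) = concat (replicate (r k - 1) [?c, x k]) @ [?c, x k]"
      using 4 concat_replicate_Suc_right[of "r k - 1" "[?c, x k]"] by simp
    moreover have "pair_block ?c x r k = pair_block ?c x ?r k"
      by (intro pair_block_cong) auto
    ultimately have "pair_block ?c x r (Suc k) @ [x m] = pair_block ?c x ?r (Suc k) @ ([?c, x k] @ [x m])"
      using 4 by (simp add: pair_block_Suc)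
    also have "\<dots> \<approx> pair_block ?c x ?r (Suc k) @ ([x k] @ [?c, x m])"
      using 4 assms Suc.prems less[of m k] lt[of k]
      by (intro chinese_cong_left pair_letter_swap) auto
    also have "\<dots> = (pair_block ?c x ?r (Suc k) @ [x k]) @ [?c, x m]" by simp
    also have "\<dots> \<approx> ([x k] @ pair_block ?c x ?r (Suc k)) @ [?c, x m]"
    proof (intro chinese_cong_right pair_block_commute pair_letter_commute)
      fix i assume "1 \<le> i" "i < Suc k"
      then show "x i \<le> x k"
        using less[of i k] Suc.prems by (cases "i = k") auto
    qed (use lt[of k] 4 in auto)
    also have "\<dots> = [x k] @ (pair_block ?c x ?r (Suc k) @ [?c, x m])" by simp
    also have "\<dots> \<approx> [x k] @ pair_block ?c x (?r(m := Suc (?r m))) (Suc k)"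
      using lt 4 assms by (intro chinese_cong_left pair_block_insert) auto
    finally show ?thesis using 4 Suc.prems by (intro exI[of _ k] exI) auto
  qed
qed

section \<open>Inserting letters into staircase words\<close>

lemma staircase_word_0 [simp]: "staircase_word x t 0 = []"
  by (simp add: staircase_word_def)

lemma staircase_word_Suc:
  "staircase_word x t (Suc n) = staircase_word x t n @ staircase_row x t (Suc n)"
  by (simp add: staircase_word_def)

lemma staircase_word_cong:
  assumes "\<And>k. k \<le> n \<Longrightarrow> t k = t' k"
  shows "staircase_word x t n = staircase_word x t' n"
  unfolding staircase_word_def staircase_row_def
  using assms by (intro arg_cong[where f = concat] map_cong) auto

text \<open>Induction on the number of rows, with \<open>m\<close> general because the top row may
  hand a different letter \<open>x j\<close> down to the smaller staircase.\<close>

lemma staircase_word_insert: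
  assumes "strict_mono_on {1..n} x" "1 \<le> m" "m \<le> n"
  shows "\<exists>t'. staircase_word x t n @ [x m] \<approx> staircase_word x t' n"
  using assms
proof (induction n arbitrary: t m)
  case (Suc n)
  let ?c = "x (Suc n)" and ?b = "\<lambda>r. pair_block (x (Suc n)) x r (Suc n)"
  have mono: "strict_mono_on {1..n} x"
    using Suc.prems(1) by (rule monotone_on_subset) auto
  have lt: "x i < ?c" if "1 \<le> i" "i < Suc n" for i
    using strict_mono_onD[OF Suc.prems(1), of i "Suc n"] that by auto
  \<comment> \<open>Overwriting row \<open>Suc n\<close> of the exponents does not affect the lower
    rows, and the diagonal entry \<open>d\<close> does not affect the pair block.\<close>
  have new: "staircase_word x s n @ ?b r @ replicate d ?c
      = staircase_word x (s(Suc n := r(Suc n := d))) (Suc n)" for s r d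
    unfolding staircase_word_Suc staircase_row_conv
    by (intro arg_cong2[where f = "(@)"] staircase_word_cong)
      (auto intro: pair_block_cong)
  have old: "staircase_word x t (Suc n)
      = staircase_word x t n @ ?b (t (Suc n)) @ replicate (t (Suc n) (Suc n)) ?c"
    by (simp add: staircase_word_Suc staircase_row_conv)
  \<comment> \<open>Either the top letter lengthens its own power, or this power is empty and the
    block bumps a letter down, or one of the \<open>Suc d\<close> top letters forms a pair with
    \<open>x m\<close>.\<close>
  consider "m = Suc n" | "m \<le> n" "t (Suc n) (Suc n) = 0"
    | d where "m \<le> n" "t (Suc n) (Suc n) = Suc d"
    using Suc.prems by (metis le_Suc_eq not0_implies_Suc)
  then show ?case
  proof cases
    case 1
    then have "staircase_word x t (Suc n) @ [x m]
        = staircase_word x t n @ ?b (t (Suc n)) @ replicate (Suc (t (Suc n) (Suc n))) ?c"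
      unfolding old by (simp add: replicate_append_same)
    then show ?thesis unfolding new by (metis chinese_cong.refl)
  next
    case 2
    obtain j r where j: "1 \<le> j" "j < Suc n" "?b (t (Suc n)) @ [x m] \<approx> [x j] @ ?b r"
      using pair_block_bump[OF Suc.prems(1), of m "Suc n"] Suc.prems 2 by force
    obtain s where s: "staircase_word x t n @ [x j] \<approx> staircase_word x s n"
      using Suc.IH[OF mono, of j t] j by auto
    have "staircase_word x t (Suc n) @ [x m] = staircase_word x t n @ (?b (t (Suc n)) @ [x m])"
      unfolding old using 2 by simp
    also have "\<dots> \<approx> staircase_word x t n @ ([x j] @ ?b r)"
      by (rule chinese_cong_left[OF j(3)])
    also have "\<dots> = (staircase_word x t n @ [x j]) @ ?b r @ replicate 0 ?c" by simp
    also have "\<dots> \<approx> staircase_word x s n @ ?b r @ replicate 0 ?c"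
      by (rule chinese_cong_right[OF s])
    finally show ?thesis unfolding new by blast
  next
    case 3
    let ?a = "x m"
    \<comment> \<open>The last \<open>?c\<close> and \<open>?a\<close> form the new pair; relation
      \<open>iij\<close> moves it left past the other \<open>d\<close> copies of
      \<open>?c\<close>.\<close>
    have comm: "[?c] @ [?c, ?a] \<approx> [?c, ?a] @ [?c]"
      using lt[of m] Suc.prems 3 by (simp add: chinese_cong.iij)
    have "staircase_word x t (Suc n) @ [x m]
        = staircase_word x t n @ ?b (t (Suc n)) @ (concat (replicate d [?c]) @ [?c, ?a])"
      unfolding old using 3 by (simp add: concat_replicate_single replicate_app_Cons_same)
    also have "\<dots> \<approx> staircase_word x t n @ ?b (t (Suc n)) @ ([?c, ?a] @ concat (replicate d [?c]))"
      by (intro chinese_cong_left chinese_cong_power_commute comm)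
    also have "\<dots> = staircase_word x t n @ (?b (t (Suc n)) @ [?c, ?a]) @ replicate d ?c"
      by (simp add: concat_replicate_single)
    also have "\<dots> \<approx> staircase_word x t n @ ?b ((t (Suc n))(m := Suc (t (Suc n) m))) @ replicate d ?c"
      using lt Suc.prems 3 by (intro chinese_cong_left chinese_cong_right pair_block_insert) auto
    finally show ?thesis unfolding new by blast
  qed
qed simp

lemma strict_mono_enumeration:
  fixes Z :: "'a::linorder set"
  assumes "finite Z"
  obtains y where "strict_mono_on {1..card Z} y" "y ` {1..card Z} = Z"
proof -
  \<comment> \<open>Staircase indices start at 1, list positions at 0.\<close>
  let ?l = "sorted_list_of_set Z" and ?y = "\<lambda>i. sorted_list_of_set Z ! (i - 1)"
  have "strict_mono_on {1..card Z} ?y"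
    using sorted_wrt_nth_less[of "(<)" ?l] by (auto simp: strict_mono_on_def strict_sorted_list_of_set)
  moreover have "?y ` Suc ` {..<card Z} = (!) ?l ` {..<card Z}"
    by (simp only: image_image diff_Suc_1)
  then have "?y ` Suc ` {..<card Z} = Z"
    using assms nth_image[of "card Z" ?l] by (simp only: lessThan_atLeast0) simp
  then have "?y ` {1..card Z} = Z"
    by (simp only: image_Suc_lessThan)
  ultimately show ?thesis using that by blast
qed

text \<open>The word is read letter by letter. The alphabet is fixed in advance as
  \<open>set w\<close>, so that all prefixes share one enumeration \<open>x\<close>; the empty
  prefix is the staircase with zero exponents.\<close>

lemma chinese_cong_staircase_word:
  fixes w :: "'a::linorder list"
  assumes "set w \<subseteq> A"
  obtains v where "v \<in> staircase_words A" "w \<approx> v"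
proof -
  obtain x where x: "strict_mono_on {1..card (set w)} x" "x ` {1..card (set w)} = set w"
    using strict_mono_enumeration[of "set w"] by auto
  have "\<exists>t. u \<approx> staircase_word x t (card (set w))" if "set u \<subseteq> set w" for u
    using that
  proof (induction u rule: rev_induct)
    case Nil
    have "staircase_word x (\<lambda>_ _. 0) n = []" for n
      by (induction n) (simp_all add: staircase_word_Suc staircase_row_def)
    then show ?case by (metis chinese_cong.refl)
  next
    case (snoc a u)
    then obtain t where "u \<approx> staircase_word x t (card (set w))" by auto
    then have "u @ [a] \<approx> staircase_word x t (card (set w)) @ [a]"
      by (rule chinese_cong_right)
    moreover obtain m where "a = x m" "1 \<le> m" "m \<le> card (set w)"
      using snoc.prems x(2) by fastforce
    ultimately show ?case
      using staircase_word_insert[OF x(1)] by (metis chinese_cong.trans)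
  qed
  then obtain t where "w \<approx> staircase_word x t (card (set w))" by blast
  moreover have "staircase_word x t (card (set w)) \<in> staircase_words A"
    unfolding staircase_words_def using x assms by blast
  ultimately show ?thesis using that by blast
qed

section \<open>Bicyclic invariants of the Chinese relations\<close>

text \<open>Right multiplication of \<open>p\<^sup>m q\<^sup>n\<close> in the bicyclic monoid, where \<open>q p = 1\<close>; acting on the right
  of a normal form is reading the word from left to right, that is, \<^const>\<open>fold\<close>.\<close>

definition bicyclic_step :: "'a set \<Rightarrow> 'a set \<Rightarrow> 'a \<Rightarrow> nat \<times> nat \<Rightarrow> nat \<times> nat" where
  "bicyclic_step P Q a = (\<lambda>(m, n).
     if a \<in> P then if n = 0 then (Suc m, 0) else (m, n - 1)
     else if a \<in> Q then (m, Suc n) else (m, n))"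

definition cut :: "'a::linorder set \<Rightarrow> 'a set \<Rightarrow> bool" where
  "cut P Q \<longleftrightarrow> (\<forall>a\<in>P. \<forall>b\<le>a. b \<in> P) \<and> (\<forall>a\<in>Q. \<forall>b\<ge>a. b \<in> Q) \<and> P \<inter> Q = {}"

text \<open>The folds are compared as functions on all states, not only at \<open>(0, 0)\<close>;
  this is what makes the relation stable under prefixes as well as suffixes.\<close>

definition chinese_inv :: "'a::linorder list \<Rightarrow> 'a list \<Rightarrow> bool" where
  "chinese_inv u v \<longleftrightarrow> mset u = mset v \<and>
     (\<forall>P Q. cut P Q \<longrightarrow> fold (bicyclic_step P Q) u = fold (bicyclic_step P Q) v)"

lemma chinese_inv_congr: "chinese_inv u v \<Longrightarrow> chinese_inv (p @ u @ q) (p @ v @ q)"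
  by (simp add: chinese_inv_def)

lemma chinese_invI:
  assumes "mset u = mset v"
    and "\<And>P Q m n. cut P Q \<Longrightarrow> fold (bicyclic_step P Q) u (m, n) = fold (bicyclic_step P Q) v (m, n)"
  shows "chinese_inv u v"
  unfolding chinese_inv_def using assms by (auto intro!: ext)

lemma cut_less:
  assumes "cut P Q" "a < b"
  shows "b \<in> P \<Longrightarrow> a \<in> P" "a \<in> Q \<Longrightarrow> b \<in> Q" "a \<in> P \<Longrightarrow> a \<notin> Q" "b \<in> P \<Longrightarrow> b \<notin> Q"
  using assms unfolding cut_def by (blast dest: less_imp_le)+

text \<open>Under a cut, the images of a decreasing sequence of letters run from \<open>q\<close>
  through 1 to \<open>p\<close>, in that order. The remaining distributions are checked with
  \<open>q p = 1\<close>.\<close>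

lemma chinese_inv_relations:
  fixes i j k :: "'a::linorder"
  shows "j < i \<Longrightarrow> k < j \<Longrightarrow> chinese_inv [i, j, k] [j, i, k]"
    and "j < i \<Longrightarrow> k < j \<Longrightarrow> chinese_inv [i, k, j] [j, i, k]"
    and "j < i \<Longrightarrow> k < j \<Longrightarrow> chinese_inv [i, j, i, k] [i, k, i, j]"
    and "j < i \<Longrightarrow> chinese_inv [i, j, j] [j, i, j]"
    and "j < i \<Longrightarrow> chinese_inv [i, i, j] [i, j, i]"
proof -
  show "chinese_inv [i, j, k] [j, i, k]" if "j < i" "k < j"
  proof (rule chinese_invI)
    fix P Q :: "'a set" and m n assume cut: "cut P Q"
    show "fold (bicyclic_step P Q) [i, j, k] (m, n) = fold (bicyclic_step P Q) [j, i, k] (m, n)"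
      using cut_less[OF cut that(1)] cut_less[OF cut that(2)] by (auto simp: bicyclic_step_def)
  qed simp
  show "chinese_inv [i, k, j] [j, i, k]" if "j < i" "k < j"
  proof (rule chinese_invI)
    fix P Q :: "'a set" and m n assume cut: "cut P Q"
    show "fold (bicyclic_step P Q) [i, k, j] (m, n) = fold (bicyclic_step P Q) [j, i, k] (m, n)"
      using cut_less[OF cut that(1)] cut_less[OF cut that(2)] by (auto simp: bicyclic_step_def)
  qed simp
  show "chinese_inv [i, j, i, k] [i, k, i, j]" if "j < i" "k < j"
  proof (rule chinese_invI)
    fix P Q :: "'a set" and m n assume cut: "cut P Q"
    show "fold (bicyclic_step P Q) [i, j, i, k] (m, n) = fold (bicyclic_step P Q) [i, k, i, j] (m, n)"
      using cut_less[OF cut that(1)] cut_less[OF cut that(2)] by (auto simp: bicyclic_step_def)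
  qed simp
  show "chinese_inv [i, j, j] [j, i, j]" if "j < i"
  proof (rule chinese_invI)
    fix P Q :: "'a set" and m n assume cut: "cut P Q"
    show "fold (bicyclic_step P Q) [i, j, j] (m, n) = fold (bicyclic_step P Q) [j, i, j] (m, n)"
      using cut_less[OF cut that] by (auto simp: bicyclic_step_def)
  qed simp
  show "chinese_inv [i, i, j] [i, j, i]" if "j < i"
  proof (rule chinese_invI)
    fix P Q :: "'a set" and m n assume cut: "cut P Q"
    show "fold (bicyclic_step P Q) [i, i, j] (m, n) = fold (bicyclic_step P Q) [i, j, i] (m, n)"
      using cut_less[OF cut that] by (auto simp: bicyclic_step_def)
  qed simp
qed

section \<open>Staircase words are determined by their invariants\<close>

lemma fold_bicyclic_step_no_Q:
  "set u \<inter> Q = {} \<Longrightarrow>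
    fold (bicyclic_step P Q) u (m, 0) = (m + size (filter_mset (\<lambda>a. a \<in> P) (mset u)), 0)"
  by (induction u arbitrary: m) (auto simp: bicyclic_step_def)

lemma fst_fold_concat:
  assumes "\<And>u s. u \<in> set us \<Longrightarrow> fst (fold f u s) = fst s"
  shows "fst (fold f (concat us) s) = fst s"
  using assms by (induction us arbitrary: s) auto

text \<open>In each pair the leading letter contributes a \<open>q\<close>, which is available to
  cancel a \<open>p\<close> coming from the second letter. Hence no new \<open>p\<close> survives,
  whatever the state before the row.\<close>

lemma fst_fold_staircase_row:
  assumes "x k \<in> Q" "P \<inter> Q = {}"
  shows "fst (fold (bicyclic_step P Q) (staircase_row x t k) s) = fst s"
proof -
  let ?f = "bicyclic_step P Q"
  have "x k \<notin> P" using assms by auto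
  then have pair: "fst (?f a (?f (x k) s)) = fst s" and letter: "fst (?f (x k) s) = fst s" for a s
    using assms by (auto simp: bicyclic_step_def split: prod.splits)
  \<comment> \<open>The final power is split into singletons, so that the row is a single
    \<open>concat\<close> of pieces each of which preserves the first component.\<close>
  have "staircase_row x t k = concat (map (\<lambda>i. concat (replicate (t k i) [x k, x i])) [1..<k]
      @ replicate (t k k) [x k])"
    by (simp add: staircase_row_def concat_replicate_single)
  then show ?thesis
    by (auto simp only: set_append set_map intro!: fst_fold_concat)
      (auto simp: pair letter intro!: fst_fold_concat dest!: in_set_replicate[THEN iffD1])
qed

lemma count_mset_pair_block:
  assumes "inj_on x {1..k}" "i \<in> {1..<k}"
  shows "count (mset (pair_block (x k) x r k)) (x i) = r i"
proof -
  have *: "count (mset (concat (replicate n [x k, x j]))) (x i) = (if i = j then n else 0)"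
    if "1 \<le> j" "j < k" for j n
  proof -
    have "x k \<noteq> x i" "x j = x i \<longleftrightarrow> i = j"
      using that assms(2) by (auto simp: inj_on_eq_iff[OF assms(1)])
    then show ?thesis by (induction n) auto
  qed
  have "count (mset (pair_block (x k) x r j)) (x i) = (if i < j then r i else 0)"
    if "j \<le> k" for j
    using that
  proof (induction j)
    case (Suc j)
    then show ?case
      using assms(2) *[of j] by (cases "j = 0") (auto simp: pair_block_Suc less_Suc_eq)
  qed simp
  then show ?thesis using assms by auto
qed

text \<open>For \<open>i < k\<close> the letter \<open>x i\<close> occurs only in its own pairs, so
  its multiplicity is the exponent \<open>t k i\<close>. Cancelling the equal pair blocks leaves the
  powers of \<open>x k\<close>.\<close>

lemma staircase_row_eqI:
  assumes "inj_on x {1..k}" and eq: "mset (staircase_row x t k) = mset (staircase_row x t' k)"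
  shows "staircase_row x t k = staircase_row x t' k"
proof -
  have "t k i = t' k i" if "i \<in> {1..<k}" for i
  proof -
    have "x i \<noteq> x k" using inj_onD[OF assms(1), of i k] that by auto
    then show ?thesis
      using arg_cong[OF eq, of "\<lambda>M. count M (x i)"] count_mset_pair_block[OF assms(1) that]
      by (simp add: staircase_row_conv)
  qed
  then have *: "pair_block (x k) x (t k) k = pair_block (x k) x (t' k) k"
    by (intro pair_block_cong) auto
  then have "replicate_mset (t k k) (x k) = replicate_mset (t' k k) (x k)"
    using eq by (simp add: staircase_row_conv)
  then have "t k k = t' k k" by (metis size_replicate_mset)
  with * show ?thesis by (simp add: staircase_row_conv)
qed

lemma set_staircase_row: "set (staircase_row x t k) \<subseteq> x ` {1..k}" if "1 \<le> k"
  using that by (auto simp: staircase_row_def split: if_splits)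

lemma set_staircase_word: "set (staircase_word x t n) \<subseteq> x ` {1..n}"
proof (induction n)
  case (Suc n)
  then show ?case
    using set_staircase_row[of "Suc n" x t] by (force simp: staircase_word_Suc)
qed simp

lemma staircase_words_subset: "w \<in> staircase_words A \<Longrightarrow> set w \<subseteq> A"
proof -
  assume "w \<in> staircase_words A"
  then obtain x t n where "w = staircase_word x t n" "x ` {1..n} \<subseteq> A"
    unfolding staircase_words_def by blast
  with set_staircase_word[of x t n] show "set w \<subseteq> A" by blast
qed

text \<open>Induction peels off the top row: suitable cuts hide it and reveal the content of the
  lower rows. The content of the top row is then the difference, and it determines that row.\<close>

lemma staircase_word_unique:
  fixes x :: "nat \<Rightarrow> 'a::linorder"
  assumes "strict_mono_on {1..n} x"
    and "mset (staircase_word x t n) = mset (staircase_word x t' n)"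
    and "\<And>P Q. cut P Q \<Longrightarrow> fst (fold (bicyclic_step P Q) (staircase_word x t n) (0, 0))
      = fst (fold (bicyclic_step P Q) (staircase_word x t' n) (0, 0))"
  shows "staircase_word x t n = staircase_word x t' n"
  using assms
proof (induction n)
  case (Suc n)
  let ?c = "x (Suc n)"
  let ?u = "staircase_word x t n" and ?u' = "staircase_word x t' n"
  have mono: "strict_mono_on {1..n} x"
    using Suc.prems(1) by (rule monotone_on_subset) auto
  have lt: "a < ?c" if "a \<in> set ?u \<union> set ?u'" for a
  proof -
    have "a \<in> x ` {1..n}"
      using that set_staircase_word[of x t n] set_staircase_word[of x t' n] by blast
    then show ?thesis by (auto intro: strict_mono_onD[OF Suc.prems(1)])
  qed
  \<comment> \<open>A cut with the top letter in \<open>Q\<close> does not see the top row.\<close>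
  have inv: "fst (fold (bicyclic_step P Q) ?u (0, 0)) = fst (fold (bicyclic_step P Q) ?u' (0, 0))"
    if "cut P Q" "?c \<in> Q" for P Q
    using Suc.prems(3)[OF that(1)] that
    by (simp add: staircase_word_Suc fst_fold_staircase_row cut_def)
  \<comment> \<open>No letter of the lower rows lies in \<open>{?c..}\<close>, so nothing cancels
    and the invariant counts their letters from \<open>P\<close>.\<close>
  have size: "size (filter_mset (\<lambda>a. a \<in> P) (mset ?u)) = size (filter_mset (\<lambda>a. a \<in> P) (mset ?u'))"
    if "cut P {?c..}" for P
  proof -
    have "set ?u \<inter> {?c..} = {}" "set ?u' \<inter> {?c..} = {}"
      using lt by (auto simp: not_le[symmetric])
    with inv[OF that] show ?thesis by (simp add: fold_bicyclic_step_no_Q)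
  qed
  have mset: "mset ?u = mset ?u'"
  proof (rule multiset_eqI)
    fix a
    show "count (mset ?u) a = count (mset ?u') a"
    proof (cases "a < ?c")
      case True
      \<comment> \<open>The multiplicity of \<open>a\<close> is the difference of the counts for the
        lower sets \<open>{..a}\<close> and \<open>{..<a}\<close>.\<close>
      have split: "size (filter_mset (\<lambda>b. b \<in> {..a}) M)
          = size (filter_mset (\<lambda>b. b \<in> {..<a}) M) + count M a" for M
        by (induction M) auto
      have "cut {..a} {?c..}" "cut {..<a} {?c..}"
        using True by (auto simp: cut_def)
      from this[THEN size] show ?thesis using split[of "mset ?u"] split[of "mset ?u'"] by linarith
    next
      case False
      then have "a \<notin> set ?u" "a \<notin> set ?u'" using lt by auto
      then show ?thesis by (metis count_mset_0_iff)
    qed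
  qed
  have "?u = ?u'"
  proof (rule Suc.IH[OF mono mset])
    fix P Q :: "'a set" assume cut: "cut P Q"
    show "fst (fold (bicyclic_step P Q) ?u (0, 0)) = fst (fold (bicyclic_step P Q) ?u' (0, 0))"
    proof (cases "?c \<in> Q")
      \<comment> \<open>As \<open>Q\<close> is an upper set, it now contains no letter below
        \<open>?c\<close> either, and equal content gives equal counts.\<close>
      case False
      then have "set ?u \<inter> Q = {}" "set ?u' \<inter> Q = {}"
        using lt cut unfolding cut_def by (blast dest: less_imp_le)+
      with mset show ?thesis by (simp add: fold_bicyclic_step_no_Q)
    qed (rule inv[OF cut])
  qed
  moreover have "staircase_row x t (Suc n) = staircase_row x t' (Suc n)"
    using strict_mono_on_imp_inj_on[OF Suc.prems(1)] Suc.prems(2) mset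
    by (intro staircase_row_eqI) (simp_all add: staircase_word_Suc)
  ultimately show ?case by (simp add: staircase_word_Suc)
qed simp

section \<open>Comparing staircase words over different alphabets\<close>

lemma concat_map_filter:
  "(\<And>a. a \<in> set xs \<Longrightarrow> \<not> R a \<Longrightarrow> f a = []) \<Longrightarrow> concat (map f xs) = concat (map f (filter R xs))"
  by (induction xs) auto

text \<open>Two staircase words can be written over the same alphabet by allowing zero exponents.\<close>

lemma staircase_word_reindex:
  fixes x y :: "nat \<Rightarrow> 'a::linorder"
  assumes x: "strict_mono_on {1..n} x" and y: "strict_mono_on {1..N} y"
    and sub: "x ` {1..n} \<subseteq> y ` {1..N}"
  obtains t' where "staircase_word x t n = staircase_word y t' N"
proof -
  \<comment> \<open>\<open>R\<close> marks the indices of \<open>y\<close> whose letter occurs in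
    \<open>x\<close>, and \<open>\<phi>\<close> translates such an index to the index of the same
    letter in \<open>x\<close>. Exponents at unmarked indices become zero.\<close>
  define R where "R k \<longleftrightarrow> y k \<in> x ` {1..n}" for k
  define \<phi> where "\<phi> k = inv_into {1..n} x (y k)" for k
  define t' where "t' k i = (if R k \<and> R i then t (\<phi> k) (\<phi> i) else 0)" for k i
  have phi: "\<phi> k \<in> {1..n}" "x (\<phi> k) = y k" if "R k" for k
    using that unfolding R_def \<phi>_def by (fact inv_into_into, fact f_inv_into_f)
  have phi_less: "\<phi> i < \<phi> k" if "R i" "R k" "1 \<le> i" "i < k" "k \<le> N" for i k
  proof -
    have "x (\<phi> i) < x (\<phi> k)"
      using strict_mono_onD[OF y, of i k] phi(2) that by simp
    then show ?thesis
      using strict_mono_on_less[OF x] phi(1) that(1,2) by blast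
  qed
  have sorted: "sorted_wrt (<) (map \<phi> (filter R [1..<k]))" if "k \<le> Suc N" for k
    unfolding sorted_wrt_map
  proof (rule sorted_wrt_mono_rel)
    show "sorted_wrt (<) (filter R [1..<k])" by (intro sorted_wrt_filter sorted_wrt_upt)
  qed (use that phi_less in auto)
  \<comment> \<open>Since \<open>\<phi>\<close> increases on marked indices, both lists are strictly
    sorted, and equality of their sets suffices.\<close>
  have upt: "map \<phi> (filter R [1..<k]) = [1..<b]"
    if "k \<le> Suc N" and "\<phi> ` {i \<in> {1..<k}. R i} = {1..<b}" for k b
  proof -
    have "set (map \<phi> (filter R [1..<k])) = {1..<b}"
      by (simp only: set_map set_filter set_upt that(2))
    then show ?thesis
      using sorted[OF that(1)] strict_sorted_equal[of "map \<phi> (filter R [1..<k])" "[1..<b]"] by simp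
  qed
  \<comment> \<open>By \<open>sub\<close> no index of \<open>x\<close> is skipped, so the marked
    indices below \<open>k\<close> are mapped onto a full initial segment.\<close>
  have preimage: "\<exists>i\<in>{1..N}. R i \<and> \<phi> i = j" if "j \<in> {1..n}" for j
  proof -
    obtain i where "i \<in> {1..N}" "x j = y i" using sub \<open>j \<in> {1..n}\<close> by blast
    then show ?thesis
      using that strict_mono_on_imp_inj_on[OF x] unfolding R_def \<phi>_def
      by (metis image_eqI inv_into_f_f)
  qed
  have rows: "map \<phi> (filter R [1..<Suc N]) = [1..<Suc n]"
  proof (rule upt)
    show "\<phi> ` {i \<in> {1..<Suc N}. R i} = {1..<Suc n}"
    proof (intro equalityI subsetI)
      fix j assume "j \<in> {1..<Suc n}"
      then obtain i where "i \<in> {1..N}" "R i" "\<phi> i = j" using preimage[of j] by auto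
      then show "j \<in> \<phi> ` {i \<in> {1..<Suc N}. R i}" by auto
    next
      fix j assume "j \<in> \<phi> ` {i \<in> {1..<Suc N}. R i}"
      then obtain i where "R i" "j = \<phi> i" by auto
      then show "j \<in> {1..<Suc n}" using phi(1)[of i] by auto
    qed
  qed simp
  have row: "staircase_row y t' k = staircase_row x t (\<phi> k)" if k: "R k" "1 \<le> k" "k \<le> N" for k
  proof -
    have "map \<phi> (filter R [1..<k]) = [1..<\<phi> k]"
    proof (intro upt equalityI subsetI)
      fix j assume j: "j \<in> {1..<\<phi> k}"
      then obtain i where i: "i \<in> {1..N}" "R i" "\<phi> i = j"
        using preimage[of j] phi[OF k(1)] by auto
      then have "i < k"
        using j phi_less[of k i] k by (cases i k rule: linorder_cases) auto
      with i show "j \<in> \<phi> ` {i \<in> {1..<k}. R i}" by auto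
    next
      fix j assume "j \<in> \<phi> ` {i \<in> {1..<k}. R i}"
      then obtain i where i: "1 \<le> i" "i < k" "R i" "j = \<phi> i" by auto
      then show "j \<in> {1..<\<phi> k}" using phi(1)[of i] phi_less[of i k] k by auto
    qed (use k in auto)
    moreover have "concat (map (\<lambda>i. concat (replicate (t' k i) [y k, y i])) [1..<k])
        = concat (map (\<lambda>i. concat (replicate (t' k i) [y k, y i])) (filter R [1..<k]))"
      by (rule concat_map_filter) (simp add: t'_def)
    moreover have "map (\<lambda>i. concat (replicate (t' k i) [y k, y i])) (filter R [1..<k])
        = map (\<lambda>i. concat (replicate (t (\<phi> k) i) [x (\<phi> k), x i])) (map \<phi> (filter R [1..<k]))"
      unfolding map_map by (rule map_cong[OF HOL.refl]) (use k in \<open>simp add: t'_def phi\<close>)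
    ultimately show ?thesis
      using k by (simp add: staircase_row_def t'_def phi)
  qed
  have "staircase_row y t' k = []" if "\<not> R k" for k
    using that by (simp add: staircase_row_def t'_def)
  then have "staircase_word y t' N = concat (map (staircase_row y t') (filter R [1..<Suc N]))"
    unfolding staircase_word_def by (intro concat_map_filter)
  also have "map (staircase_row y t') (filter R [1..<Suc N])
      = map (staircase_row x t) (map \<phi> (filter R [1..<Suc N]))"
    unfolding map_map by (rule map_cong[OF HOL.refl]) (auto intro!: row)
  finally show ?thesis
    using that unfolding rows staircase_word_def by metis
qed

text \<open>The two words may come with different sequences of letters; both are rewritten over the
  increasing enumeration of the union.\<close>

lemma staircase_words_inv_eq:
  assumes "u \<in> staircase_words A" "v \<in> staircase_words A" "chinese_inv u v"
  shows "u = v"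
proof -
  obtain x t n where x: "strict_mono_on {1..n} x" "u = staircase_word x t n"
    using assms(1) by (auto simp: staircase_words_def)
  obtain x' t' n' where x': "strict_mono_on {1..n'} x'" "v = staircase_word x' t' n'"
    using assms(2) by (auto simp: staircase_words_def)
  obtain y where y: "strict_mono_on {1..card (x ` {1..n} \<union> x' ` {1..n'})} y"
    "y ` {1..card (x ` {1..n} \<union> x' ` {1..n'})} = x ` {1..n} \<union> x' ` {1..n'}"
    using strict_mono_enumeration[of "x ` {1..n} \<union> x' ` {1..n'}"] by auto
  obtain s where s: "u = staircase_word y s (card (x ` {1..n} \<union> x' ` {1..n'}))"
    using staircase_word_reindex[OF x(1) y(1)] y(2) x(2) by (metis sup_ge1)
  obtain s' where s': "v = staircase_word y s' (card (x ` {1..n} \<union> x' ` {1..n'}))"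
    using staircase_word_reindex[OF x'(1) y(1)] y(2) x'(2) by (metis sup_ge2)
  show ?thesis
    using assms(3) unfolding s s' chinese_inv_def by (intro staircase_word_unique[OF y(1)]) simp_all
qed

section \<open>Linear functionals and the ideal they annihilate\<close>

definition lin_ext :: "('b \<Rightarrow> 'k::field) \<Rightarrow> ('b \<Rightarrow>\<^sub>0 'k) \<Rightarrow> 'k" where
  "lin_ext g p = (\<Sum>w\<in>Poly_Mapping.keys p. Poly_Mapping.lookup p w * g w)"

lemma lin_ext_superset:
  assumes "finite X" "Poly_Mapping.keys p \<subseteq> X"
  shows "lin_ext g p = (\<Sum>w\<in>X. Poly_Mapping.lookup p w * g w)"
  unfolding lin_ext_def using assms
  by (intro sum.mono_neutral_left) (auto simp: in_keys_iff)

lemma lin_ext_0 [simp]: "lin_ext g 0 = 0"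
  by (simp add: lin_ext_def)

lemma lin_ext_single [simp]: "lin_ext g (Poly_Mapping.single w c) = c * g w"
  by (simp add: lin_ext_def)

lemma lin_ext_add: "lin_ext g (p + q) = lin_ext g p + lin_ext g q"
proof -
  let ?X = "Poly_Mapping.keys p \<union> Poly_Mapping.keys q"
  have "lin_ext g r = (\<Sum>w\<in>?X. Poly_Mapping.lookup r w * g w)" if "Poly_Mapping.keys r \<subseteq> ?X" for r
    using that by (intro lin_ext_superset) auto
  from this[of p] this[of q] this[of "p + q"] show ?thesis
    using Poly_Mapping.keys_add[of p q] by (simp add: lookup_add algebra_simps sum.distrib)
qed

lemma lin_ext_uminus: "lin_ext g (- p) = - lin_ext g p"
  using lin_ext_add[of g p "- p"] by (simp add: add_eq_0_iff)

lemma lin_ext_diff: "lin_ext g (p - q) = lin_ext g p - lin_ext g q"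
  using lin_ext_add[of g p "- q"] by (simp add: lin_ext_uminus)

lemma lin_ext_sum: "lin_ext g (\<Sum>i\<in>X. p i) = (\<Sum>i\<in>X. lin_ext g (p i))"
  by (induction X rule: infinite_finite_induct) (simp_all add: lin_ext_add)

lemma poly_mapping_sum_single:
  "p = (\<Sum>w\<in>Poly_Mapping.keys p. Poly_Mapping.single w (Poly_Mapping.lookup p w))"
proof (rule poly_mapping_eqI)
  fix v
  show "Poly_Mapping.lookup p v
      = Poly_Mapping.lookup (\<Sum>w\<in>Poly_Mapping.keys p. Poly_Mapping.single w (Poly_Mapping.lookup p w)) v"
    by (simp add: lookup_sum lookup_single when_def in_keys_iff sum.delta)
qed

lemma sum_product_single:
  fixes a b :: "'b::monoid_add \<Rightarrow> 'k::field"
  shows "(\<Sum>u\<in>X. Poly_Mapping.single u (a u)) * (\<Sum>v\<in>Y. Poly_Mapping.single v (b v))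
    = (\<Sum>u\<in>X. \<Sum>v\<in>Y. Poly_Mapping.single (u + v) (a u * b v))"
  by (simp add: sum_product mult_single)

text \<open>The two orders of evaluation serve the two sides of the ideal property: the inner
  functional can always be applied to the factor that lies in the kernel.\<close>

lemma lin_ext_mult:
  fixes p q :: "'b::monoid_add \<Rightarrow>\<^sub>0 'k::field"
  shows "lin_ext g (p * q) = lin_ext (\<lambda>u. lin_ext (\<lambda>v. g (u + v)) q) p"
    and "lin_ext g (p * q) = lin_ext (\<lambda>v. lin_ext (\<lambda>u. g (u + v)) p) q"
proof -
  have "p * q = (\<Sum>u\<in>Poly_Mapping.keys p. \<Sum>v\<in>Poly_Mapping.keys q.
      Poly_Mapping.single (u + v) (Poly_Mapping.lookup p u * Poly_Mapping.lookup q v))"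
    unfolding sum_product_single[symmetric] poly_mapping_sum_single[symmetric] ..
  then have *: "lin_ext g (p * q) = (\<Sum>u\<in>Poly_Mapping.keys p. \<Sum>v\<in>Poly_Mapping.keys q.
      Poly_Mapping.lookup p u * Poly_Mapping.lookup q v * g (u + v))"
    by (simp add: lin_ext_sum)
  show "lin_ext g (p * q) = lin_ext (\<lambda>u. lin_ext (\<lambda>v. g (u + v)) q) p"
    unfolding * by (simp add: lin_ext_def sum_distrib_left mult.assoc)
  show "lin_ext g (p * q) = lin_ext (\<lambda>v. lin_ext (\<lambda>u. g (u + v)) p) q"
    unfolding * by (subst sum.swap) (simp add: lin_ext_def sum_distrib_left mult.assoc mult.left_commute)
qed

text \<open>This is the kernel of the map from the free algebra to the monoid algebra of words
  modulo \<open>chinese_inv\<close>, described by functionals instead of a quotient.\<close>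

definition invariant_kernel :: "'a::linorder set \<Rightarrow> ('a list \<Rightarrow>\<^sub>0 'k::field) set" where
  "invariant_kernel A = {p \<in> carrier (free_algebra A).
     \<forall>g. (\<forall>u v. chinese_inv u v \<longrightarrow> g u = g v) \<longrightarrow> lin_ext g p = 0}"

lemma free_algebra_simps:
  "carrier (free_algebra A) = {p. Poly_Mapping.keys p \<subseteq> lists A}"
  "p \<oplus>\<^bsub>free_algebra A\<^esub> q = p + q" "p \<otimes>\<^bsub>free_algebra A\<^esub> q = p * q" "\<zero>\<^bsub>free_algebra A\<^esub> = 0"
  by (simp_all add: free_algebra_def)

lemma free_algebra_a_inv:
  assumes "p \<in> carrier (free_algebra A)"
  shows "\<ominus>\<^bsub>free_algebra A\<^esub> p = - p"
proof -
  interpret ring "free_algebra A :: ('k::field, 'a list \<Rightarrow>\<^sub>0 'k) module"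
    by (rule ring_free_algebra)
  show ?thesis
    using assms by (intro minus_equality) (simp_all add: free_algebra_simps)
qed

text \<open>Translating an invariant function by a word on either side yields an invariant function,
  because \<open>chinese_inv\<close> is a two-sided congruence.\<close>

lemma ideal_invariant_kernel:
  "ideal (invariant_kernel A) (free_algebra A :: ('k::field, 'a::linorder list \<Rightarrow>\<^sub>0 'k) module)"
proof -
  let ?F = "free_algebra A :: ('k, 'a list \<Rightarrow>\<^sub>0 'k) module"
  interpret ring ?F by (rule ring_free_algebra)
  let ?inv = "\<lambda>g :: 'a list \<Rightarrow> 'k. \<forall>u v. chinese_inv u v \<longrightarrow> g u = g v"
  have left: "?inv (\<lambda>v. g (u + v))" and right: "?inv (\<lambda>v. g (v + u))" if "?inv g" for g u
    using that chinese_inv_congr[of _ _ u "[]"] chinese_inv_congr[of _ _ "[]" u]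
    by (auto simp: plus_list_def)
  show ?thesis
  proof (rule idealI)
    show "subgroup (invariant_kernel A) (add_monoid ?F)"
    proof (rule add.subgroupI)
      fix p :: "'a list \<Rightarrow>\<^sub>0 'k" assume "p \<in> invariant_kernel A"
      then show "\<ominus>\<^bsub>?F\<^esub> p \<in> invariant_kernel A"
        using free_algebra_a_inv[of p A] a_inv_closed[of p]
        by (auto simp: invariant_kernel_def lin_ext_uminus)
    next
      fix p q :: "'a list \<Rightarrow>\<^sub>0 'k"
      assume "p \<in> invariant_kernel A" "q \<in> invariant_kernel A"
      then show "p \<oplus>\<^bsub>?F\<^esub> q \<in> invariant_kernel A"
        using a_closed[of p q] by (auto simp: invariant_kernel_def lin_ext_add free_algebra_simps(2))
    next
      have "0 \<in> invariant_kernel A"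
        using zero_closed by (simp add: invariant_kernel_def free_algebra_simps)
      then show "invariant_kernel A \<noteq> ({} :: ('a list \<Rightarrow>\<^sub>0 'k) set)" by blast
    qed (auto simp: invariant_kernel_def)
  next
    fix p q :: "'a list \<Rightarrow>\<^sub>0 'k"
    assume p: "p \<in> invariant_kernel A" and q: "q \<in> carrier ?F"
    then have pF: "p \<in> carrier ?F" by (simp add: invariant_kernel_def)
    have "lin_ext g (q * p) = 0" "lin_ext g (p * q) = 0" if "?inv g" for g
      using p left[OF that] right[OF that]
      by (auto simp: invariant_kernel_def lin_ext_mult(1)[of g q p] lin_ext_mult(2)[of g p q])
        (auto simp: lin_ext_def)
    then show "q \<otimes>\<^bsub>?F\<^esub> p \<in> invariant_kernel A" "p \<otimes>\<^bsub>?F\<^esub> q \<in> invariant_kernel A"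
      using m_closed[OF q pF] m_closed[OF pF q]
      by (auto simp: invariant_kernel_def free_algebra_simps(3))
  qed (rule ring_free_algebra)
qed

lemma chinese_relations_subset_invariant_kernel: "chinese_relations A \<subseteq> invariant_kernel A"
proof
  fix p assume p: "p \<in> chinese_relations A"
  then have "\<exists>u v. chinese_inv u v \<and> p = word u - word v"
    unfolding chinese_relations_def
    by (elim UnE CollectE exE conjE) (blast intro: chinese_inv_relations)+
  with subsetD[OF chinese_relations_carrier p] show "p \<in> invariant_kernel A"
    by (auto simp: invariant_kernel_def lin_ext_diff)
qed

lemma chinese_relationsI:
  assumes "i \<in> A" "j \<in> A" "j < i"
  shows "k \<in> A \<Longrightarrow> k < j \<Longrightarrow> word [i, j, k] - word [j, i, k] \<in> chinese_relations A"
    and "k \<in> A \<Longrightarrow> k < j \<Longrightarrow> word [i, k, j] - word [j, i, k] \<in> chinese_relations A"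
    and "k \<in> A \<Longrightarrow> k < j \<Longrightarrow> word [i, j, i, k] - word [i, k, i, j] \<in> chinese_relations A"
    and "word [i, j, j] - word [j, i, j] \<in> chinese_relations A"
    and "word [i, i, j] - word [i, j, i] \<in> chinese_relations A"
  unfolding chinese_relations_def Un_iff mem_Collect_eq using assms by blast+

lemma equivp_chinese_inv: "equivp chinese_inv"
  by (rule equivpI) (simp_all add: reflp_def symp_def transp_def chinese_inv_def)

section \<open>The basis of the Chinese algebra\<close>

context
  fixes A :: "'a::linorder set" and S I F V
  defines "S \<equiv> chinese_relations A :: ('a list \<Rightarrow>\<^sub>0 'k::field) set"
    and "F \<equiv> free_algebra A :: ('k, 'a list \<Rightarrow>\<^sub>0 'k) module"
    and "V \<equiv> presented_algebra A S"
    and "I \<equiv> Idl\<^bsub>F\<^esub> S"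
begin

interpretation F: ring F unfolding F_def by (rule ring_free_algebra)

lemma S_carrier: "S \<subseteq> carrier F"
  unfolding S_def F_def by (rule chinese_relations_carrier)

interpretation I: ideal I F
  unfolding I_def by (rule F.genideal_ideal[OF S_carrier])

interpretation V: vectorspace class_ring V
  unfolding V_def
  by (rule vectorspace_presented_algebra[OF S_carrier[unfolded F_def]])

lemma V_eq: "V = quot_algebra (free_algebra A) I"
  by (simp add: V_def presented_algebra_def I_def F_def)

lemma ideal_I: "ideal I (free_algebra A)"
  using I.ideal_axioms by (simp add: F_def)

lemmas V_ring_simps = quot_algebra_ring_simps[OF ideal_I, folded V_eq F_def]

lemma V_smult: "p \<in> carrier F \<Longrightarrow> c \<odot>\<^bsub>V\<^esub> (I +>\<^bsub>F\<^esub> p) = I +>\<^bsub>F\<^esub> (Poly_Mapping.single 0 c * p)"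
  using quot_algebra_smult[OF ideal_I, of p c] smult_conv_mult[OF ideal_I, of c p]
  by (simp add: V_eq F_def free_algebra_simps)

lemma V_add: "p \<in> carrier F \<Longrightarrow> q \<in> carrier F \<Longrightarrow>
    (I +>\<^bsub>F\<^esub> p) \<oplus>\<^bsub>V\<^esub> (I +>\<^bsub>F\<^esub> q) = I +>\<^bsub>F\<^esub> (p + q)"
  using I.a_rcos_sum[of p q] by (simp add: V_ring_simps FactRing_def F_def free_algebra_simps)

lemma coset_carrier: "p \<in> carrier F \<Longrightarrow> I +>\<^bsub>F\<^esub> p \<in> carrier V"
  by (auto simp: V_ring_simps FactRing_simps)

lemma coset_0: "I +>\<^bsub>F\<^esub> 0 = \<zero>\<^bsub>V\<^esub>"
  using I.a_rcos_const[of 0] I.zero_closed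
  by (simp add: V_ring_simps FactRing_def F_def free_algebra_simps)

lemma coset_eqD:
  assumes "p \<in> carrier F" "q \<in> carrier F" "I +>\<^bsub>F\<^esub> p = I +>\<^bsub>F\<^esub> q"
  shows "p - q \<in> I"
proof -
  have "p \<in> I +>\<^bsub>F\<^esub> q" using I.a_rcos_self[OF assms(1)] assms(3) by simp
  then obtain h where "h \<in> I" "p = h + q"
    by (auto simp: a_r_coset_def r_coset_def F_def free_algebra_simps)
  then show ?thesis by simp
qed

lemma coset_eqI:
  assumes "p \<in> carrier F" "q \<in> carrier F" "p - q \<in> I"
  shows "I +>\<^bsub>F\<^esub> p = I +>\<^bsub>F\<^esub> q"
proof -
  have "p = (p - q) \<oplus>\<^bsub>F\<^esub> q" by (simp add: F_def free_algebra_simps)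
  then have "p \<in> I +>\<^bsub>F\<^esub> q"
    using assms(3) unfolding a_r_coset_def r_coset_def by (auto simp: F_def)
  then show ?thesis
    using assms(2) F.a_repr_independence[OF _ _ I.a_subgroup] by metis
qed

text \<open>\<open>I\<close> is the least ideal containing the relations, hence it lies inside
  \<open>invariant_kernel A\<close>.\<close>

lemma lin_ext_ideal:
  assumes "p \<in> I" "\<And>u v. chinese_inv u v \<Longrightarrow> g u = g v"
  shows "lin_ext g p = 0"
proof -
  have "I \<subseteq> invariant_kernel A"
    unfolding I_def
    by (rule F.genideal_minimal)
      (use ideal_invariant_kernel chinese_relations_subset_invariant_kernel in \<open>auto simp: F_def S_def\<close>)
  with assms show ?thesis by (auto simp: invariant_kernel_def)
qed

lemma single_carrier: "set w \<subseteq> A \<Longrightarrow> Poly_Mapping.single w c \<in> carrier F"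
  by (auto simp: F_def free_algebra_simps)

text \<open>The closure rules of the congruence become closure properties of the ideal: symmetry is
  negation, transitivity is addition, and \<open>congr\<close> is multiplication by words on both
  sides.\<close>

lemma chinese_cong_word_diff:
  assumes "u \<approx> v" "set u \<subseteq> A"
  shows "word u - word v \<in> I"
proof -
  have gen: "p \<in> I" if "p \<in> S" for p
    using that F.genideal_self[OF S_carrier] by (auto simp: I_def)
  show ?thesis using assms
  proof (induction rule: chinese_cong.induct)
    case (refl u)
    then show ?case using I.zero_closed by (simp add: F_def free_algebra_simps)
  next
    case (sym u v)
    then have "word u - word v \<in> I" using chinese_cong_set_eq by blast
    moreover from this have "word u - word v \<in> carrier F" by (rule I.a_Hcarr)
    then have "\<ominus>\<^bsub>F\<^esub> (word u - word v) = - (word u - word v)"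
      unfolding F_def by (rule free_algebra_a_inv)
    ultimately show ?case using I.a_inv_closed by (metis minus_diff_eq)
  next
    case (trans u v w)
    then have "(word u - word v) \<oplus>\<^bsub>F\<^esub> (word v - word w) \<in> I"
      using chinese_cong_set_eq[OF trans.hyps(1)] by (intro I.a_closed) auto
    then show ?case by (simp add: F_def free_algebra_simps)
  next
    case (congr u v p q)
    then have "word p \<otimes>\<^bsub>F\<^esub> (word u - word v) \<otimes>\<^bsub>F\<^esub> word q \<in> I"
      by (intro I.I_l_closed I.I_r_closed single_carrier) auto
    then show ?case
      by (simp add: F_def free_algebra_simps algebra_simps mult_single plus_list_def)
  qed (rule gen, unfold S_def, rule chinese_relationsI; simp)+
qed

lemma word_class_eq: "word_class A S w = I +>\<^bsub>F\<^esub> word w"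
  by (simp add: word_class_def I_def F_def)

lemma V_smult_word: "set w \<subseteq> A \<Longrightarrow> c \<odot>\<^bsub>V\<^esub> word_class A S w = I +>\<^bsub>F\<^esub> Poly_Mapping.single w c"
  using V_smult[OF single_carrier[of w 1], of c] by (simp add: word_class_eq mult_single)

lemma sum_single_carrier:
  "\<forall>w\<in>X. set w \<subseteq> A \<Longrightarrow> (\<Sum>w\<in>X. Poly_Mapping.single w (c w)) \<in> carrier F"
proof (induction X rule: infinite_finite_induct)
  case (insert w X)
  then have "Poly_Mapping.single w (c w) \<oplus>\<^bsub>F\<^esub> (\<Sum>w\<in>X. Poly_Mapping.single w (c w)) \<in> carrier F"
    by (intro F.a_closed single_carrier) auto
  then show ?case
    using insert.hyps by (simp add: F_def free_algebra_simps(2))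
next
  case empty
  show ?case using F.zero_closed by (simp add: F_def free_algebra_simps(4))
next
  case (infinite X)
  then show ?case using F.zero_closed by (simp add: F_def free_algebra_simps(4))
qed

text \<open>Translates combinations in the quotient into polynomials. Combinations there run over
  sets of classes, so injectivity keeps different words from merging into one summand.\<close>

lemma lincomb_word_class:
  assumes "finite W" "inj_on (word_class A S) W" "\<forall>w\<in>W. set w \<subseteq> A"
  shows "V.lincomb a (word_class A S ` W)
    = I +>\<^bsub>F\<^esub> (\<Sum>w\<in>W. Poly_Mapping.single w (a (word_class A S w)))"
  using assms
proof (induction W rule: finite_induct)
  case empty
  show ?case by (simp add: V.lincomb_def coset_0)
next
  case (insert w W)
  let ?c = "word_class A S"
  have smult: "a (?c v) \<odot>\<^bsub>V\<^esub> ?c v \<in> carrier V" if "set v \<subseteq> A" for v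
    using that by (simp add: V_smult_word coset_carrier single_carrier)
  have "?c w \<notin> ?c ` W" using insert by auto
  then have "V.lincomb a (?c ` insert w W) = a (?c w) \<odot>\<^bsub>V\<^esub> ?c w \<oplus>\<^bsub>V\<^esub> V.lincomb a (?c ` W)"
    unfolding V.lincomb_def image_insert using insert.hyps insert.prems
    by (intro V.finsum_insert) (auto intro: smult)
  also have "\<dots> = I +>\<^bsub>F\<^esub> (Poly_Mapping.single w (a (?c w)) + (\<Sum>w\<in>W. Poly_Mapping.single w (a (?c w))))"
    using insert by (simp add: V_smult_word V_add single_carrier sum_single_carrier)
  finally show ?case using insert by simp
qed

text \<open>The indicator of the invariant class of \<open>v\<close> annihilates \<open>I\<close>.
  Within \<open>W\<close> this class contains only \<open>v\<close>, so the functional reads off the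
  coefficient \<open>c v\<close>.\<close>

lemma staircase_words_independent:
  assumes "finite W" "W \<subseteq> staircase_words A" "(\<Sum>w\<in>W. Poly_Mapping.single w (c w)) \<in> I" "v \<in> W"
  shows "c v = 0"
proof -
  let ?g = "\<lambda>w. of_bool (chinese_inv v w) :: 'k"
  have "lin_ext ?g (\<Sum>w\<in>W. Poly_Mapping.single w (c w)) = 0"
  proof (rule lin_ext_ideal[OF assms(3)])
    fix u w :: "'a list" assume "chinese_inv u w"
    then have "chinese_inv v u \<longleftrightarrow> chinese_inv v w"
      using equivp_symp[OF equivp_chinese_inv] equivp_transp[OF equivp_chinese_inv] by blast
    then show "?g u = ?g w" by (simp only:)
  qed
  then have "0 = (\<Sum>w\<in>W. c w * ?g w)" by (simp add: lin_ext_sum)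
  also have "\<dots> = (\<Sum>w\<in>W. if w = v then c w else 0)"
  proof (rule sum.cong[OF HOL.refl])
    fix w assume "w \<in> W"
    with assms have "v \<in> staircase_words A" "w \<in> staircase_words A" by blast+
    then have "chinese_inv v w \<longleftrightarrow> w = v"
      using staircase_words_inv_eq[of v A w] equivp_reflp[OF equivp_chinese_inv, of v] by blast
    then show "c w * ?g w = (if w = v then c w else 0)" by simp
  qed
  finally show ?thesis using assms(1,4) by simp
qed

lemma inj_on_word_class: "inj_on (word_class A S) (staircase_words A)"
proof (rule inj_onI, rule ccontr)
  fix u v assume uv: "u \<in> staircase_words A" "v \<in> staircase_words A"
    "word_class A S u = word_class A S v" "u \<noteq> v"
  then have "word u - word v \<in> I"
    by (intro coset_eqD single_carrier staircase_words_subset) (simp_all only: word_class_eq)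
  \<comment> \<open>Two distinct staircase words with the same class would give a combination in
    \<open>I\<close> with coefficients 1 and -1.\<close>
  moreover have "(\<Sum>w\<in>{u, v}. Poly_Mapping.single w (if w = u then 1 else - 1 :: 'k)) = word u - word v"
    using uv(4) by (simp add: single_uminus)
  ultimately have "(\<Sum>w\<in>{u, v}. Poly_Mapping.single w (if w = u then 1 else - 1 :: 'k)) \<in> I"
    by (simp only:)
  then have "(if u = u then 1 else - 1 :: 'k) = 0"
    using uv(1,2) by (intro staircase_words_independent[of "{u, v}"]) blast+
  then show False by simp
qed

text \<open>Every word class is the class of a staircase word, which gives spanning. A linear
  dependence lifts along the injective class map to a combination of staircase words lying in
  \<open>I\<close>.\<close>

lemma basis_word_class: "V.basis (word_class A S ` staircase_words A)"
  unfolding V.basis_def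
proof (intro conjI equalityI)
  let ?c = "word_class A S" and ?\<Omega> = "staircase_words A"
  show sub: "?c ` ?\<Omega> \<subseteq> carrier V"
    using staircase_words_subset by (auto simp: word_class_eq intro!: coset_carrier single_carrier)
  then show "V.span (?c ` ?\<Omega>) \<subseteq> carrier V" by (rule V.span_is_subset2)
  interpret span: submodule class_ring "V.span (?c ` ?\<Omega>)" V
    by (rule V.span_is_submodule[OF sub])
  have word: "?c w \<in> V.span (?c ` ?\<Omega>)" if w: "set w \<subseteq> A" for w
  proof -
    obtain v where v: "v \<in> ?\<Omega>" "w \<approx> v" using chinese_cong_staircase_word[OF w] by blast
    then have "?c w = ?c v"
      using w chinese_cong_word_diff[OF v(2)] staircase_words_subset[of v]
      unfolding word_class_eq by (intro coset_eqI single_carrier) auto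
    with v(1) show ?thesis using V.in_own_span[OF sub] by auto
  qed
  have span: "I +>\<^bsub>F\<^esub> (\<Sum>w\<in>X. Poly_Mapping.single w (a w)) \<in> V.span (?c ` ?\<Omega>)"
    if "finite X" "\<forall>w\<in>X. set w \<subseteq> A" for X and a :: "'a list \<Rightarrow> 'k"
    using that
  proof (induction X rule: finite_induct)
    case empty
    then show ?case using V.span_zero by (simp add: coset_0)
  next
    case (insert w X)
    have "a w \<odot>\<^bsub>V\<^esub> ?c w \<in> V.span (?c ` ?\<Omega>)"
      using word insert.prems by (intro span.smult_closed) (auto simp: class_ring_simps)
    then have "a w \<odot>\<^bsub>V\<^esub> ?c w \<oplus>\<^bsub>V\<^esub> (I +>\<^bsub>F\<^esub> (\<Sum>w\<in>X. Poly_Mapping.single w (a w))) \<in> V.span (?c ` ?\<Omega>)"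
      using insert by (intro span.m_closed[simplified]) auto
    then show ?case
      using insert by (simp add: V_smult_word V_add single_carrier sum_single_carrier)
  qed
  show "carrier V \<subseteq> V.span (?c ` ?\<Omega>)"
  proof
    fix U assume "U \<in> carrier V"
    then obtain p where p: "p \<in> carrier F" "U = I +>\<^bsub>F\<^esub> p"
      by (auto simp: V_ring_simps FactRing_simps)
    then show "U \<in> V.span (?c ` ?\<Omega>)"
      using span[of "Poly_Mapping.keys p" "Poly_Mapping.lookup p"] poly_mapping_sum_single[of p]
      by (auto simp: F_def free_algebra_simps)
  qed
  show "V.lin_indpt (?c ` ?\<Omega>)"
  proof
    assume "V.lin_dep (?c ` ?\<Omega>)"
    then obtain B a U where B: "finite B" "B \<subseteq> ?c ` ?\<Omega>" "V.lincomb a B = \<zero>\<^bsub>V\<^esub>" "U \<in> B" "a U \<noteq> 0"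
      unfolding V.lin_dep_def by (auto simp: class_ring_simps)
    obtain W where W: "finite W" "W \<subseteq> ?\<Omega>" "B = ?c ` W"
      using finite_subset_image[OF B(1,2)] by metis
    have inj: "inj_on ?c W" using inj_on_word_class W(2) by (rule inj_on_subset)
    have WA: "\<forall>w\<in>W. set w \<subseteq> A" using W(2) staircase_words_subset by blast
    \<comment> \<open>The subtracted 0 represents the zero coset, so that \<open>coset_eqD\<close>
      applies.\<close>
    have "(\<Sum>w\<in>W. Poly_Mapping.single w (a (?c w))) - 0 \<in> I"
    proof (intro coset_eqD sum_single_carrier WA)
      show "0 \<in> carrier F" using F.zero_closed by (simp add: F_def free_algebra_simps(4))
      show "I +>\<^bsub>F\<^esub> (\<Sum>w\<in>W. Poly_Mapping.single w (a (?c w))) = I +>\<^bsub>F\<^esub> 0"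
        using B(3) unfolding W(3) coset_0 lincomb_word_class[OF W(1) inj WA] .
    qed
    then have "(\<Sum>w\<in>W. Poly_Mapping.single w (a (?c w))) \<in> I" by (simp only: diff_zero)
    moreover obtain v where "v \<in> W" "U = ?c v" using B(4) W(3) by blast
    ultimately show False
      using staircase_words_independent[OF W(1,2)] B(5) by metis
  qed
qed

end

theorem theorem2p3:
  fixes A :: "'a::linorder set" and S :: "('a list \<Rightarrow>\<^sub>0 'k::field) set"
  assumes "wfp_on A (<)"
    and "S = chinese_relations A"
  shows "inj_on (word_class A S) (staircase_words A) \<and>
    vectorspace.basis class_ring (presented_algebra A S) (word_class A S ` staircase_words A)"
  unfolding assms(2) by (rule conjI[OF inj_on_word_class basis_word_class])

end
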